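(* The dual space of an $n$-ary partially coassociative coalgebra is provided with a structure of $n$-ary partially associative algebra.
   Context: $\mathbb{K}$ is a commutative field of characteristic $0$, all vector spaces are over $\mathbb{K}$, and $n$ is a natural number; $Id_q$ is the identity of the $q$-th tensor power ($Id_0$ means no operation). An $n$-ary partially associative algebra is a vector space $\mathcal A$ with a linear map $\mu:\mathcal A^{\otimes n}\to\mathcal A$ such that $\sum_{p=0}^{n-1}(-1)^{p(n-1)}\mu\circ(Id_p\otimes\mu\otimes Id_{n-1-p})=0$. An $n$-ary partially coassociative coalgebra is a vector space $M$ with a linear map $\Delta:M\to M^{\otimes n}$ such that $\sum_{p=0}^{n-1}(-1)^{p(n-1)}(Id_p\otimes\Delta\otimes Id_{n-1-p})\circ\Delta=0$. The dual space of $M$ is $M^*=\mathrm{Hom}_{\mathbb{K}}(M,\mathbb{K})$. *)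

theory Defs
  imports Complex_Main "HOL-Library.Function_Algebras"
begin

text \<open>A vector space is given by a scalar multiplication on a type together with a linear
  subspace of that type, its carrier.  Only the values of a map on the carrier matter.\<close>

definition linear_on ::
  "('k::field \<Rightarrow> 'v::ab_group_add \<Rightarrow> 'v) \<Rightarrow> 'v set \<Rightarrow> ('k \<Rightarrow> 'w::ab_group_add \<Rightarrow> 'w) \<Rightarrow> ('v \<Rightarrow> 'w) \<Rightarrow> bool"
  where "linear_on s V s' f \<longleftrightarrow>
    (\<forall>x\<in>V. \<forall>y\<in>V. f (x + y) = f x + f y) \<and> (\<forall>c. \<forall>x\<in>V. f (s c x) = s' c (f x))"

definition fscale :: "'k::field \<Rightarrow> ('a \<Rightarrow> 'k) \<Rightarrow> 'a \<Rightarrow> 'k"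
  where "fscale c f = (\<lambda>x. c * f x)"

text \<open>The lists of length \<open>q\<close> with entries in \<open>V\<close> represent the cartesian power of \<open>V\<close>.\<close>

definition tuples :: "'v set \<Rightarrow> nat \<Rightarrow> 'v list set"
  where "tuples V q = {xs. length xs = q \<and> set xs \<subseteq> V}"

definition multilinear_on ::
  "('k::field \<Rightarrow> 'v::ab_group_add \<Rightarrow> 'v) \<Rightarrow> 'v set \<Rightarrow> nat \<Rightarrow> ('k \<Rightarrow> 'w::ab_group_add \<Rightarrow> 'w) \<Rightarrow>
   ('v list \<Rightarrow> 'w) \<Rightarrow> bool"
  where "multilinear_on s V q s' g \<longleftrightarrow>
    (\<forall>xs\<in>tuples V q. \<forall>i<q. linear_on s V s' (\<lambda>v. g (xs[i := v])))"

text \<open>The tensor power is realised inside the space of functionals on the multilinear forms: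
  the tensor \<open>x\<^sub>1 \<otimes> \<dots> \<otimes> x\<^sub>q\<close> is evaluation of \<open>q\<close>-linear forms at the tuple, and the tensor power
  is the span of these.  The lemmas \<open>multilinear_pure_tensor\<close>, \<open>tensor_lift\<close> and
  \<open>tensor_power_unique\<close> establish the universal property.\<close>

type_synonym ('v, 'k) tensor = "('v list \<Rightarrow> 'k) \<Rightarrow> 'k"

definition pure_tensor ::
  "('k::field \<Rightarrow> 'v::ab_group_add \<Rightarrow> 'v) \<Rightarrow> 'v set \<Rightarrow> 'v list \<Rightarrow> ('v, 'k) tensor"
  where "pure_tensor s V xs = (\<lambda>\<phi>. if multilinear_on s V (length xs) (*) \<phi> then \<phi> xs else 0)"

definition tensor_power ::
  "('k::field \<Rightarrow> 'v::ab_group_add \<Rightarrow> 'v) \<Rightarrow> 'v set \<Rightarrow> nat \<Rightarrow> ('v, 'k) tensor set"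
  where "tensor_power s V q = module.span fscale (pure_tensor s V ` tuples V q)"

text \<open>The linear map on the \<open>q\<close>-th tensor power of \<open>V\<close> induced by a \<open>q\<close>-linear map \<open>g\<close>.\<close>

definition tensor_lift ::
  "('k::field \<Rightarrow> 'v::ab_group_add \<Rightarrow> 'v) \<Rightarrow> 'v set \<Rightarrow> nat \<Rightarrow> ('k \<Rightarrow> 'w::ab_group_add \<Rightarrow> 'w) \<Rightarrow>
   ('v list \<Rightarrow> 'w) \<Rightarrow> ('v, 'k) tensor \<Rightarrow> 'w"
  where "tensor_lift s V q s' g =
    (SOME L. linear_on fscale (tensor_power s V q) s' L \<and>
      (\<forall>xs\<in>tuples V q. L (pure_tensor s V xs) = g xs))"

text \<open>The identification of \<open>V\<^bsup>\<otimes>p\<^esup> \<otimes> V\<^bsup>\<otimes>q\<^esup>\<close> with \<open>V\<^bsup>\<otimes>(p+q)\<^esup>\<close>.\<close>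

definition tensor_concat ::
  "('k::field \<Rightarrow> 'v::ab_group_add \<Rightarrow> 'v) \<Rightarrow> 'v set \<Rightarrow> nat \<Rightarrow> nat \<Rightarrow>
   ('v, 'k) tensor \<Rightarrow> ('v, 'k) tensor \<Rightarrow> ('v, 'k) tensor"
  where "tensor_concat s V p q t u =
    tensor_lift s V p fscale
      (\<lambda>xs. tensor_lift s V q fscale (\<lambda>ys. pure_tensor s V (xs @ ys)) u) t"

text \<open>The map \<open>Id\<^sub>p \<otimes> G \<otimes> Id\<^sub>r\<close>, where the linear map \<open>G\<close> from the \<open>a\<close>-th to the \<open>b\<close>-th tensor power of
  \<open>V\<close> is given by the \<open>a\<close>-linear map \<open>g\<close> with \<open>g [x\<^sub>1, \<dots>, x\<^sub>a] = G (x\<^sub>1 \<otimes> \<dots> \<otimes> x\<^sub>a)\<close>.\<close>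

definition id_tensor_id ::
  "('k::field \<Rightarrow> 'v::ab_group_add \<Rightarrow> 'v) \<Rightarrow> 'v set \<Rightarrow> nat \<Rightarrow> nat \<Rightarrow> nat \<Rightarrow> ('v list \<Rightarrow> ('v, 'k) tensor) \<Rightarrow>
   nat \<Rightarrow> ('v, 'k) tensor \<Rightarrow> ('v, 'k) tensor"
  where "id_tensor_id s V p a b g r =
    tensor_lift s V (p + a + r) fscale
      (\<lambda>xs. tensor_concat s V p (b + r) (pure_tensor s V (take p xs))
        (tensor_concat s V b r (g (take a (drop p xs))) (pure_tensor s V (drop (p + a) xs))))"

text \<open>In both locales the linear map is viewed as a map between tensor powers by identifying the
  carrier with its first tensor power, \<open>v\<close> corresponding to \<open>pure_tensor scale A [v]\<close>.\<close>

locale partially_associative_algebra = vector_space scale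
  for scale :: "'k::field_char_0 \<Rightarrow> 'v::ab_group_add \<Rightarrow> 'v" +
  fixes A :: "'v set" and n :: nat and \<mu> :: "('v, 'k) tensor \<Rightarrow> 'v"
  assumes carrier: "subspace A"
    and mult_closed: "\<mu> ` tensor_power scale A n \<subseteq> A"
    and mult_linear: "linear_on fscale (tensor_power scale A n) scale \<mu>"
    and partially_associative: "\<And>t. t \<in> tensor_power scale A (2 * n - 1) \<Longrightarrow>
      (\<Sum>p<n. scale ((- 1) ^ (p * (n - 1)))
        (\<mu> (id_tensor_id scale A p n 1 (\<lambda>ys. pure_tensor scale A [\<mu> (pure_tensor scale A ys)])
          (n - 1 - p) t))) = 0"

locale partially_coassociative_coalgebra = vector_space scale
  for scale :: "'k::field_char_0 \<Rightarrow> 'v::ab_group_add \<Rightarrow> 'v" +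
  fixes M :: "'v set" and n :: nat and \<Delta> :: "'v \<Rightarrow> ('v, 'k) tensor"
  assumes carrier: "subspace M"
    and comult_closed: "\<Delta> ` M \<subseteq> tensor_power scale M n"
    and comult_linear: "linear_on scale M fscale \<Delta>"
    and partially_coassociative: "\<And>x. x \<in> M \<Longrightarrow>
      (\<Sum>p<n. fscale ((- 1) ^ (p * (n - 1)))
        (id_tensor_id scale M p 1 n (\<lambda>ys. \<Delta> (hd ys)) (n - 1 - p) (\<Delta> x))) = 0"

text \<open>Linear forms on \<open>M\<close>, extended by \<open>0\<close> outside \<open>M\<close> so that each form is a single function.\<close>

definition dual_space ::
  "('k::field \<Rightarrow> 'v::ab_group_add \<Rightarrow> 'v) \<Rightarrow> 'v set \<Rightarrow> ('v \<Rightarrow> 'k) set"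
  where "dual_space s M = {f. linear_on s M (*) f \<and> (\<forall>x. x \<notin> M \<longrightarrow> f x = 0)}"

text \<open>The form \<open>x\<^sub>1 \<otimes> \<dots> \<otimes> x\<^sub>q \<mapsto> f\<^sub>1 x\<^sub>1 \<cdots> f\<^sub>q x\<^sub>q\<close> on the tensor power.\<close>

definition tensor_form ::
  "('k::field \<Rightarrow> 'v::ab_group_add \<Rightarrow> 'v) \<Rightarrow> 'v set \<Rightarrow> ('v \<Rightarrow> 'k) list \<Rightarrow> ('v, 'k) tensor \<Rightarrow> 'k"
  where "tensor_form s M fs =
    tensor_lift s M (length fs) (*) (\<lambda>xs. \<Prod>i<length fs. (fs ! i) (xs ! i))"

text \<open>The transpose of \<open>\<Delta>\<close>: the linear map \<open>f\<^sub>1 \<otimes> \<dots> \<otimes> f\<^sub>n \<mapsto> (f\<^sub>1 \<otimes> \<dots> \<otimes> f\<^sub>n) \<circ> \<Delta>\<close>.\<close>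

definition dual_mult ::
  "('k::field \<Rightarrow> 'v::ab_group_add \<Rightarrow> 'v) \<Rightarrow> 'v set \<Rightarrow> nat \<Rightarrow> ('v \<Rightarrow> ('v, 'k) tensor) \<Rightarrow>
   ('v \<Rightarrow> 'k, 'k) tensor \<Rightarrow> 'v \<Rightarrow> 'k"
  where "dual_mult s M n \<Delta> =
    tensor_lift fscale (dual_space s M) n fscale
      (\<lambda>fs x. if x \<in> M then tensor_form s M fs (\<Delta> x) else 0)"


lemma vector_space_fscale: "vector_space (fscale :: 'k::field \<Rightarrow> ('a \<Rightarrow> 'k) \<Rightarrow> 'a \<Rightarrow> 'k)"
  by unfold_locales (auto simp: fscale_def fun_eq_iff algebra_simps)

interpretation fscale: vector_space "fscale :: 'k::field \<Rightarrow> ('a \<Rightarrow> 'k) \<Rightarrow> 'a \<Rightarrow> 'k"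
  by (rule vector_space_fscale)

lemma tuples_update: "xs \<in> tuples V q \<Longrightarrow> v \<in> V \<Longrightarrow> xs[i := v] \<in> tuples V q"
  using set_update_subset_insert[of xs i v] by (auto simp: tuples_def)

lemma pure_tensor_in: "xs \<in> tuples V q \<Longrightarrow> pure_tensor s V xs \<in> tensor_power s V q"
  unfolding tensor_power_def by (intro fscale.span_base) auto

lemma multilinear_pure_tensor:
  assumes "vector_space s" "module.subspace s V"
  shows "multilinear_on s V q fscale (pure_tensor s V)"
proof -
  interpret vector_space s by fact
  have add: "\<And>x y. x \<in> V \<Longrightarrow> y \<in> V \<Longrightarrow> x + y \<in> V" and sc: "\<And>c x. x \<in> V \<Longrightarrow> s c x \<in> V"
    using assms(2) by (auto simp: subspace_def)
  show ?thesis
    unfolding multilinear_on_def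
  proof (intro ballI allI impI)
    fix xs :: "'b list" and i assume xs: "xs \<in> tuples V q" and i: "i < q"
    then have len: "length xs = q" by (simp add: tuples_def)
    have ml: "linear_on s V (*) (\<lambda>v. \<phi> (xs[i := v]))" if "multilinear_on s V q (*) \<phi>" for \<phi>
      using that xs i by (auto simp: multilinear_on_def)
    show "linear_on s V fscale (\<lambda>v. pure_tensor s V (xs[i := v]))"
      unfolding linear_on_def
    proof (intro conjI ballI allI)
      fix x y assume "x \<in> V" "y \<in> V"
      then show "pure_tensor s V (xs[i := x + y]) =
          pure_tensor s V (xs[i := x]) + pure_tensor s V (xs[i := y])"
        using ml by (auto simp: pure_tensor_def fun_eq_iff len linear_on_def)
    next
      fix c x assume "x \<in> V"
      then show "pure_tensor s V (xs[i := s c x]) = fscale c (pure_tensor s V (xs[i := x]))"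
        using ml by (auto simp: pure_tensor_def fun_eq_iff len linear_on_def fscale_def)
    qed
  qed
qed

lemma pure_tensor_relation:
  fixes s :: "'k::field \<Rightarrow> 'v::ab_group_add \<Rightarrow> 'v" and s' :: "'k \<Rightarrow> 'w::ab_group_add \<Rightarrow> 'w"
  assumes W: "vector_space s'" and g: "multilinear_on s V q s' g"
    and S: "S \<subseteq> tuples V q" "finite S"
    and z: "(\<Sum>xs\<in>S. fscale (c xs) (pure_tensor s V xs)) = 0"
  shows "(\<Sum>xs\<in>S. s' (c xs) (g xs)) = 0"
proof (rule ccontr)
  interpret W: vector_space s' by fact
  interpret K: vector_space "(*) :: 'k \<Rightarrow> 'k \<Rightarrow> 'k"
    by unfold_locales (auto simp: algebra_simps)
  interpret WK: vector_space_pair s' "(*) :: 'k \<Rightarrow> 'k \<Rightarrow> 'k" ..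
  let ?w = "\<Sum>xs\<in>S. s' (c xs) (g xs)"
  assume w: "?w \<noteq> 0"
  then have "W.independent {?w}" by simp
  then obtain h where h: "Vector_Spaces.linear s' (*) h" and h1: "h ?w = 1"
    using WK.linear_independent_extend[of "{?w}" "\<lambda>_. 1"] by auto
  interpret h: Vector_Spaces.linear s' "(*)" h by fact
  have ml: "multilinear_on s V q (*) (\<lambda>xs. h (g xs))"
    using g by (simp add: multilinear_on_def linear_on_def h.add h.scale)
  have "0 = (\<Sum>xs\<in>S. fscale (c xs) (pure_tensor s V xs)) (\<lambda>xs. h (g xs))"
    by (simp add: z)
  also have "\<dots> = (\<Sum>xs\<in>S. c xs * pure_tensor s V xs (\<lambda>xs. h (g xs)))"
    using S(2) by (induction S rule: finite_induct) (auto simp: fscale_def)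
  also have "\<dots> = (\<Sum>xs\<in>S. c xs * h (g xs))"
    using S(1) ml by (intro sum.cong) (auto simp: pure_tensor_def tuples_def)
  also have "\<dots> = h ?w" by (simp add: h.sum h.scale)
  finally show False using h1 by simp
qed

lemma tensor_lift_exists:
  fixes s :: "'k::field \<Rightarrow> 'v::ab_group_add \<Rightarrow> 'v" and s' :: "'k \<Rightarrow> 'w::ab_group_add \<Rightarrow> 'w"
  assumes W: "vector_space s'" and g: "multilinear_on s V q s' g"
  shows "\<exists>L. Vector_Spaces.linear fscale s' L \<and> (\<forall>xs\<in>tuples V q. L (pure_tensor s V xs) = g xs)"
proof -
  interpret W: vector_space s' by fact
  interpret P: vector_space_pair "fscale :: 'k \<Rightarrow> ('v, 'k) tensor \<Rightarrow> _" s' ..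
  obtain B where B: "B \<subseteq> pure_tensor s V ` tuples V q" "fscale.independent B"
    "pure_tensor s V ` tuples V q \<subseteq> fscale.span B"
    using fscale.maximal_independent_subset[of "pure_tensor s V ` tuples V q"] by metis
  from B(1) obtain T where T: "T \<subseteq> tuples V q" "B = pure_tensor s V ` T" "inj_on (pure_tensor s V) T"
    by (meson subset_image_inj)
  obtain L where L: "Vector_Spaces.linear fscale s' L"
    and LB: "\<And>b. b \<in> B \<Longrightarrow> L b = g (inv_into T (pure_tensor s V) b)"
    using P.linear_independent_extend[OF B(2), of "\<lambda>b. g (inv_into T (pure_tensor s V) b)"] by metis
  interpret L: Vector_Spaces.linear fscale s' L by fact
  have LT: "L (pure_tensor s V ys) = g ys" if "ys \<in> T" for ys
    using LB[of "pure_tensor s V ys"] that T by auto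
  have "L (pure_tensor s V xs) = g xs" if xs: "xs \<in> tuples V q" for xs
  proof (cases "xs \<in> T")
    case True then show ?thesis by (rule LT)
  next
    case False
    from B(3) xs have "pure_tensor s V xs \<in> fscale.span B" by auto
    then obtain C r where C: "finite C" "C \<subseteq> B" and
      eq: "pure_tensor s V xs = (\<Sum>b\<in>C. fscale (r b) b)"
      unfolding fscale.span_explicit by auto
    from C(2) T obtain D where D: "D \<subseteq> T" "C = pure_tensor s V ` D" "inj_on (pure_tensor s V) D"
      by (meson subset_image_inj inj_on_subset)
    have finD: "finite D" using C(1) D finite_image_iff by blast
    let ?r = "\<lambda>ys. r (pure_tensor s V ys)"
    have eq': "pure_tensor s V xs = (\<Sum>ys\<in>D. fscale (?r ys) (pure_tensor s V ys))"
      unfolding eq D(2) using D(3) by (simp add: sum.reindex)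
    let ?c = "\<lambda>ys. if ys = xs then - 1 else ?r ys"
    have xD: "xs \<notin> D" using False D by auto
    have cD: "(\<Sum>ys\<in>D. f (?c ys) ys) = (\<Sum>ys\<in>D. f (?r ys) ys)"
      for f :: "'k \<Rightarrow> 'v list \<Rightarrow> 'z::ab_group_add"
      using xD by (intro sum.cong) auto
    have "(\<Sum>ys\<in>insert xs D. fscale (?c ys) (pure_tensor s V ys)) = 0"
      using finD xD cD[of "\<lambda>a ys. fscale a (pure_tensor s V ys)"] eq' by simp
    then have "(\<Sum>ys\<in>insert xs D. s' (?c ys) (g ys)) = 0"
      using xs D T finD by (intro pure_tensor_relation[OF W g]) auto
    then have "g xs = (\<Sum>ys\<in>D. s' (?r ys) (g ys))"
      using finD xD cD[of "\<lambda>a ys. s' a (g ys)"] by simp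
    also have "\<dots> = (\<Sum>ys\<in>D. s' (?r ys) (L (pure_tensor s V ys)))"
      using LT D by (intro sum.cong) auto
    also have "\<dots> = L (pure_tensor s V xs)"
      by (subst eq') (simp add: L.sum L.scale)
    finally show ?thesis by simp
  qed
  with L show ?thesis by blast
qed

lemma tensor_lift:
  fixes s :: "'k::field \<Rightarrow> 'v::ab_group_add \<Rightarrow> 'v" and s' :: "'k \<Rightarrow> 'w::ab_group_add \<Rightarrow> 'w"
  assumes W: "vector_space s'" and g: "multilinear_on s V q s' g"
  shows linear_tensor_lift: "linear_on fscale (tensor_power s V q) s' (tensor_lift s V q s' g)"
    and tensor_lift_pure: "\<And>xs. xs \<in> tuples V q \<Longrightarrow> tensor_lift s V q s' g (pure_tensor s V xs) = g xs"
proof -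
  obtain L where L: "Vector_Spaces.linear fscale s' L"
    and LP: "\<forall>xs\<in>tuples V q. L (pure_tensor s V xs) = g xs"
    using tensor_lift_exists[OF W g] by blast
  interpret L: Vector_Spaces.linear fscale s' L by fact
  have "\<exists>L. linear_on fscale (tensor_power s V q) s' L \<and>
      (\<forall>xs\<in>tuples V q. L (pure_tensor s V xs) = g xs)"
    using LP by (intro exI[of _ L]) (auto simp: linear_on_def L.add L.scale)
  from someI_ex[OF this]
  show "linear_on fscale (tensor_power s V q) s' (tensor_lift s V q s' g)"
    and "\<And>xs. xs \<in> tuples V q \<Longrightarrow> tensor_lift s V q s' g (pure_tensor s V xs) = g xs"
    unfolding tensor_lift_def by auto
qed

lemma tensor_power_unique:
  fixes s :: "'k::field \<Rightarrow> 'v::ab_group_add \<Rightarrow> 'v" and s' :: "'k \<Rightarrow> 'w::ab_group_add \<Rightarrow> 'w"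
  assumes W: "vector_space s'"
    and L: "linear_on fscale (tensor_power s V q) s' L" "linear_on fscale (tensor_power s V q) s' L'"
    and eq: "\<And>xs. xs \<in> tuples V q \<Longrightarrow> L (pure_tensor s V xs) = L' (pure_tensor s V xs)"
    and t: "t \<in> tensor_power s V q"
  shows "L t = L' t"
proof -
  interpret W: vector_space s' by fact
  have mem: "0 \<in> tensor_power s V q"
    unfolding tensor_power_def by (rule fscale.span_zero)
  have zero: "F 0 = 0" if "linear_on fscale (tensor_power s V q) s' F" for F
  proof -
    have "F (fscale 0 0) = s' 0 (F 0)" using that mem unfolding linear_on_def by blast
    then show ?thesis by simp
  qed
  have "t \<in> fscale.span (pure_tensor s V ` tuples V q)" using t by (simp add: tensor_power_def)
  then have "t \<in> tensor_power s V q \<and> L t = L' t"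
  proof (induction rule: fscale.span_induct_alt)
    case base then show ?case using mem zero[OF L(1)] zero[OF L(2)] by metis
  next
    case (step c x y)
    then obtain xs where xs: "xs \<in> tuples V q" "x = pure_tensor s V xs" by auto
    have x: "x \<in> tensor_power s V q" using xs pure_tensor_in by blast
    have cx: "fscale c x \<in> tensor_power s V q"
      using x unfolding tensor_power_def by (rule fscale.span_scale)
    have y: "y \<in> tensor_power s V q" using step by blast
    have cxy: "fscale c x + y \<in> tensor_power s V q"
      using cx y unfolding tensor_power_def by (rule fscale.span_add)
    have lin: "F (fscale c x + y) = s' c (F x) + F y" if "linear_on fscale (tensor_power s V q) s' F" for F
      using that x cx y by (simp add: linear_on_def)
    then show ?case using lin[OF L(1)] lin[OF L(2)] eq[OF xs(1)] xs(2) step cxy by metis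
  qed
  then show ?thesis by blast
qed

end

theory Submission
  imports Defs
begin

text \<open>For forms \<open>f\<^sub>1, \<dots>, f\<^sub>2\<^sub>n\<^sub>-\<^sub>1\<close> on \<open>M\<close>, evaluating
  \<open>\<mu> (f\<^sub>1, \<dots>, f\<^sub>p, \<mu> (f\<^sub>p\<^sub>+\<^sub>1, \<dots>, f\<^sub>p\<^sub>+\<^sub>n), \<dots>, f\<^sub>2\<^sub>n\<^sub>-\<^sub>1)\<close> at \<open>x\<close> amounts to applying
  \<open>f\<^sub>1 \<otimes> \<dots> \<otimes> f\<^sub>2\<^sub>n\<^sub>-\<^sub>1\<close> to \<open>(Id\<^sub>p \<otimes> \<Delta> \<otimes> Id\<^sub>n\<^sub>-\<^sub>1\<^sub>-\<^sub>p) (\<Delta> x)\<close>, because \<open>f\<^sub>1 \<otimes> \<dots> \<otimes> f\<^sub>2\<^sub>n\<^sub>-\<^sub>1\<close> is multiplicative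
  for the concatenation of tensors.  Hence the signed sum expressing partial associativity is the
  image of the vanishing sum of partial coassociativity under a linear form.\<close>

section \<open>Linear and multilinear maps, tensor powers\<close>

lemma vector_space_mult: "vector_space ((*) :: 'k::field \<Rightarrow> 'k \<Rightarrow> 'k)"
  by unfold_locales (auto simp: algebra_simps)

lemma linear_onI:
  assumes "\<And>x y. x \<in> V \<Longrightarrow> y \<in> V \<Longrightarrow> f (x + y) = f x + f y"
    and "\<And>c x. x \<in> V \<Longrightarrow> f (s c x) = s' c (f x)"
  shows "linear_on s V s' f"
  using assms by (simp add: linear_on_def)

lemma linear_on_compose:
  assumes "linear_on s V s' f" "linear_on s' V' s'' g" "\<And>x. x \<in> V \<Longrightarrow> f x \<in> V'"
  shows "linear_on s V s'' (\<lambda>x. g (f x))"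
  using assms by (simp add: linear_on_def)

text \<open>Linearity on \<open>V\<close> tests \<open>f\<close> at sums and multiples as well, so
  agreement on \<open>V\<close> carries over because \<open>V\<close> is closed under both. This
  allows replacing a form by its extension by \<open>0\<close>.\<close>

lemma linear_on_cong:
  assumes "\<And>x. x \<in> V \<Longrightarrow> f x = g x" "module.subspace s V" "vector_space s"
  shows "linear_on s V s' f \<longleftrightarrow> linear_on s V s' g"
proof -
  interpret vector_space s by fact
  show ?thesis
    using assms(1) subspace_add[OF assms(2)] subspace_scale[OF assms(2)]
    by (auto simp: linear_on_def)
qed

lemma linear_on_scale:
  assumes "vector_space s'" "linear_on s V s' f"
  shows "linear_on s V s' (\<lambda>x. s' c (f x))"
proof -
  interpret W: vector_space s' by fact
  show ?thesis
    using assms(2) by (auto simp: linear_on_def W.scale_right_distrib mult.commute)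
qed

lemma linear_on_sum:
  assumes "vector_space s'" "\<And>i. i \<in> I \<Longrightarrow> linear_on s V s' (f i)"
  shows "linear_on s V s' (\<lambda>x. \<Sum>i\<in>I. f i x)"
proof -
  interpret W: vector_space s' by fact
  show ?thesis
    using assms(2) by (auto simp: linear_on_def sum.distrib W.scale_sum_right intro!: sum.cong)
qed

lemma linear_on_zero_map:
  assumes "vector_space s'"
  shows "linear_on s V s' (\<lambda>x. 0)"
proof -
  interpret W: vector_space s' by fact
  show ?thesis by (simp add: linear_on_def)
qed

lemma linear_on_0:
  assumes "vector_space s" "vector_space s'" "linear_on s V s' f" "0 \<in> V"
  shows "f 0 = 0"
proof -
  interpret V: vector_space s by fact
  interpret W: vector_space s' by fact
  have "f (s 0 0) = s' 0 (f 0)" using assms(3,4) unfolding linear_on_def by blast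
  then show ?thesis by simp
qed

lemma linear_on_of_sum:
  assumes "vector_space s" "vector_space s'" "linear_on s V s' f" "module.subspace s V"
    and "\<And>i. i \<in> I \<Longrightarrow> x i \<in> V"
  shows "f (\<Sum>i\<in>I. s (c i) (x i)) = (\<Sum>i\<in>I. s' (c i) (f (x i)))"
proof -
  interpret V: vector_space s by fact
  interpret W: vector_space s' by fact
  \<comment> \<open>Additivity of \<open>f\<close> holds only on \<open>V\<close>, so the induction
    also carries membership of the partial sums.\<close>
  have "(\<Sum>i\<in>I. s (c i) (x i)) \<in> V \<and> f (\<Sum>i\<in>I. s (c i) (x i)) = (\<Sum>i\<in>I. s' (c i) (f (x i)))"
    using assms(5)
  proof (induction I rule: infinite_finite_induct)
    case (insert i I)
    then have "x i \<in> V" "s (c i) (x i) \<in> V"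
      using V.subspace_scale[OF assms(4)] by auto
    with insert show ?case
      using assms(3) V.subspace_add[OF assms(4)] by (simp add: linear_on_def)
  qed (use linear_on_0[OF assms(1-3)] V.subspace_0[OF assms(4)] in auto)
  then show ?thesis ..
qed

lemma fscale_apply: "fscale c f x = c * f x"
  by (simp add: fscale_def)

lemma sum_fun_apply: "(\<Sum>i\<in>I. f i) x = (\<Sum>i\<in>I. f i x :: 'a::comm_monoid_add)"
  by (induction I rule: infinite_finite_induct) auto

text \<open>Isolates the one factor that depends on \<open>v\<close>. Taking \<open>h j\<close> to
  be the \<open>j\<close>-th form gives linearity in a vector; taking it to be evaluation at the
  \<open>j\<close>-th vector gives linearity in a form.\<close>

lemma prod_update:
  fixes h :: "nat \<Rightarrow> 'a \<Rightarrow> 'b::comm_monoid_mult"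
  assumes "i < length xs" "length xs = m"
  shows "(\<Prod>j<m. h j (xs[i := v] ! j)) = h i v * (\<Prod>j\<in>{..<m} - {i}. h j (xs ! j))"
proof -
  have "(\<Prod>j<m. h j (xs[i := v] ! j)) =
      h i (xs[i := v] ! i) * (\<Prod>j\<in>{..<m} - {i}. h j (xs[i := v] ! j))"
    using assms by (intro prod.remove) auto
  also have "(\<Prod>j\<in>{..<m} - {i}. h j (xs[i := v] ! j)) = (\<Prod>j\<in>{..<m} - {i}. h j (xs ! j))"
    by (intro prod.cong) auto
  finally show ?thesis using assms by simp
qed

text \<open>The computation on pure tensors behind the multiplicativity of
  \<open>tensor_form\<close> under concatenation.\<close>

lemma prod_append:
  fixes fs gs :: "('a \<Rightarrow> 'b::comm_monoid_mult) list"
  assumes "length xs = length fs"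
  shows "(\<Prod>i<length (fs @ gs). ((fs @ gs) ! i) ((xs @ ys) ! i)) =
    (\<Prod>i<length fs. (fs ! i) (xs ! i)) * (\<Prod>i<length gs. (gs ! i) (ys ! i))"
  using assms
proof (induction fs arbitrary: xs)
  case (Cons f fs)
  then obtain x xs' where "xs = x # xs'" by (cases xs) auto
  with Cons show ?case by (simp add: prod.lessThan_Suc_shift mult.assoc del: prod.lessThan_Suc)
qed simp

section \<open>Multilinear maps and tuples\<close>

lemma multilinear_onI:
  assumes "\<And>xs i. xs \<in> tuples V q \<Longrightarrow> i < q \<Longrightarrow> linear_on s V s' (\<lambda>v. g (xs[i := v]))"
  shows "multilinear_on s V q s' g"
  using assms by (simp add: multilinear_on_def)

lemma multilinear_onD:
  "multilinear_on s V q s' g \<Longrightarrow> xs \<in> tuples V q \<Longrightarrow> i < q \<Longrightarrow>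
    linear_on s V s' (\<lambda>v. g (xs[i := v]))"
  by (simp add: multilinear_on_def)

lemma multilinear_on_compose:
  assumes "multilinear_on s V q s' g" "linear_on s' V' s'' h" "\<And>xs. xs \<in> tuples V q \<Longrightarrow> g xs \<in> V'"
  shows "multilinear_on s V q s'' (\<lambda>xs. h (g xs))"
  using assms by (simp add: multilinear_on_def linear_on_def tuples_update)

lemma tuples_append: "xs \<in> tuples V p \<Longrightarrow> ys \<in> tuples V q \<Longrightarrow> xs @ ys \<in> tuples V (p + q)"
  by (auto simp: tuples_def)

lemma tuples_take: "xs \<in> tuples V q \<Longrightarrow> p \<le> q \<Longrightarrow> take p xs \<in> tuples V p"
  by (auto simp: tuples_def dest: in_set_takeD)

lemma tuples_drop: "xs \<in> tuples V q \<Longrightarrow> q = p + r \<Longrightarrow> drop p xs \<in> tuples V r"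
  by (auto simp: tuples_def dest: in_set_dropD)

lemma tuples_singleton: "v \<in> V \<Longrightarrow> [v] \<in> tuples V 1"
  by (simp add: tuples_def)

section \<open>Linear maps on tensor powers\<close>

lemma subspace_tensor_power: "fscale.subspace (tensor_power s V q)"
  unfolding tensor_power_def by simp

lemma tensor_power_closed:
  fixes s :: "'k::field \<Rightarrow> 'v::ab_group_add \<Rightarrow> 'v" and s' :: "'k \<Rightarrow> 'w::ab_group_add \<Rightarrow> 'w"
  assumes W: "vector_space s'" and L: "linear_on fscale (tensor_power s V q) s' L"
    and U: "module.subspace s' U"
    and pure: "\<And>xs. xs \<in> tuples V q \<Longrightarrow> L (pure_tensor s V xs) \<in> U"
    and t: "t \<in> tensor_power s V q"
  shows "L t \<in> U"
proof -
  interpret W: vector_space s' by fact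
  have "t \<in> fscale.span (pure_tensor s V ` tuples V q)" using t by (simp add: tensor_power_def)
  \<comment> \<open>\<open>L\<close> is linear only on the tensor power, hence the first
    conjunct.\<close>
  then have "t \<in> tensor_power s V q \<and> L t \<in> U"
  proof (induction rule: fscale.span_induct_alt)
    case base
    then show ?case
      using linear_on_0[OF vector_space_fscale W L] fscale.subspace_0[OF subspace_tensor_power]
        W.subspace_0[OF U] by metis
  next
    case (step c x y)
    then obtain xs where xs: "xs \<in> tuples V q" "x = pure_tensor s V xs" by auto
    have x: "x \<in> tensor_power s V q" using xs pure_tensor_in by blast
    have cx: "fscale c x \<in> tensor_power s V q"
      by (rule fscale.subspace_scale[OF subspace_tensor_power x])
    have "L (fscale c x + y) = s' c (L x) + L y" using L x cx step by (simp add: linear_on_def)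
    then show ?case
      using cx step xs pure W.subspace_add[OF U] W.subspace_scale[OF U]
        fscale.subspace_add[OF subspace_tensor_power] by metis
  qed
  then show ?thesis ..
qed

text \<open>Each lift is picked by \<open>SOME\<close>, so linear dependence on the parameter
  \<open>v\<close> is not visible from the definition. It follows from uniqueness: the two sides are
  linear in \<open>t\<close> and agree on pure tensors.\<close>

lemma tensor_lift_linear_param:
  fixes s :: "'k::field \<Rightarrow> 'v::ab_group_add \<Rightarrow> 'v" and s' :: "'k \<Rightarrow> 'w::ab_group_add \<Rightarrow> 'w"
    and s'' :: "'k \<Rightarrow> 'u::ab_group_add \<Rightarrow> 'u"
  assumes W: "vector_space s'" and U: "vector_space s''" "module.subspace s'' U"
    and G: "\<And>v. v \<in> U \<Longrightarrow> multilinear_on s V q s' (G v)"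
    and lin: "\<And>xs. xs \<in> tuples V q \<Longrightarrow> linear_on s'' U s' (\<lambda>v. G v xs)"
    and t: "t \<in> tensor_power s V q"
  shows "linear_on s'' U s' (\<lambda>v. tensor_lift s V q s' (G v) t)"
proof (rule linear_onI)
  interpret W: vector_space s' by fact
  interpret U: vector_space s'' by fact
  note lift = tensor_lift[OF W G]
  fix x y assume xy: "x \<in> U" "y \<in> U"
  then have xy': "x + y \<in> U" using U.subspace_add U(2) by blast
  have "linear_on fscale (tensor_power s V q) s'
      (\<lambda>t. tensor_lift s V q s' (G x) t + tensor_lift s V q s' (G y) t)"
    using lift(1)[OF xy(1)] lift(1)[OF xy(2)] by (simp add: linear_on_def W.scale_right_distrib)
  from tensor_power_unique[OF W lift(1)[OF xy'] this _ t]
  show "tensor_lift s V q s' (G (x + y)) t = tensor_lift s V q s' (G x) t + tensor_lift s V q s' (G y) t"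
    using lin xy xy' lift(2) by (simp add: linear_on_def)
next
  interpret W: vector_space s' by fact
  interpret U: vector_space s'' by fact
  note lift = tensor_lift[OF W G]
  fix c x assume x: "x \<in> U"
  then have cx: "s'' c x \<in> U" using U.subspace_scale U(2) by blast
  have "linear_on fscale (tensor_power s V q) s' (\<lambda>t. s' c (tensor_lift s V q s' (G x) t))"
    using linear_on_scale[OF W lift(1)[OF x]] .
  from tensor_power_unique[OF W lift(1)[OF cx] this _ t]
  show "tensor_lift s V q s' (G (s'' c x)) t = s' c (tensor_lift s V q s' (G x) t)"
    using lin x cx lift(2) by (simp add: linear_on_def)
qed

section \<open>Concatenation of tensors\<close>

text \<open>Serves twice below, once for the coalgebra and once for its dual, so that the calculus
  of tensors is developed only once.\<close>

locale carrier_space = vector_space scale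
  for scale :: "'k::field \<Rightarrow> 'v::ab_group_add \<Rightarrow> 'v" +
  fixes V :: "'v set"
  assumes carrier: "subspace V"
begin

abbreviation "tp \<equiv> tensor_power scale V"
abbreviation "pure \<equiv> pure_tensor scale V"
abbreviation "concat_tp \<equiv> tensor_concat scale V"

lemma multilinear_pure: "multilinear_on scale V q fscale pure"
  by (rule multilinear_pure_tensor) (use carrier vector_space_axioms in auto)

lemma linear_pure_append:
  assumes "xs \<in> tuples V p" "ys \<in> tuples V q"
  shows "i < p \<Longrightarrow> linear_on scale V fscale (\<lambda>v. pure (xs[i := v] @ ys))"
    and "i < q \<Longrightarrow> linear_on scale V fscale (\<lambda>v. pure (xs @ ys[i := v]))"
proof -
  have len: "length xs = p" using assms by (simp add: tuples_def)
  note D = multilinear_onD[OF multilinear_pure tuples_append[OF assms]]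
  show "linear_on scale V fscale (\<lambda>v. pure (xs[i := v] @ ys))" if "i < p"
    using D[of i] that len by (simp add: list_update_append)
  show "linear_on scale V fscale (\<lambda>v. pure (xs @ ys[i := v]))" if "i < q"
    \<comment> \<open>Position \<open>i\<close> of the second block is position \<open>p + i\<close>
      of the whole tuple.\<close>
    using D[of "p + i"] that len by (simp add: list_update_append)
qed

lemma multilinear_concat_right:
  "xs \<in> tuples V p \<Longrightarrow> multilinear_on scale V q fscale (\<lambda>ys. pure (xs @ ys))"
  by (intro multilinear_onI linear_pure_append(2))

text \<open>Makes the outer lift in \<open>tensor_concat\<close> meaningful: the inner lift varies
  linearly with each entry of \<open>xs\<close>, since the map being lifted does.\<close>

lemma multilinear_concat_left:
  assumes "u \<in> tp q"
  shows "multilinear_on scale V p fscale (\<lambda>xs. tensor_lift scale V q fscale (\<lambda>ys. pure (xs @ ys)) u)"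
proof (rule multilinear_onI)
  fix xs i assume xs: "xs \<in> tuples V p" and i: "i < p"
  show "linear_on scale V fscale
      (\<lambda>v. tensor_lift scale V q fscale (\<lambda>ys. pure (xs[i := v] @ ys)) u)"
    by (rule tensor_lift_linear_param[OF vector_space_fscale vector_space_axioms carrier
          multilinear_concat_right[OF tuples_update[OF xs]] linear_pure_append(1)[OF xs _ i] assms])
qed

lemma tensor_concat_pure_left:
  assumes "xs \<in> tuples V p" "u \<in> tp q"
  shows "concat_tp p q (pure xs) u = tensor_lift scale V q fscale (\<lambda>ys. pure (xs @ ys)) u"
  unfolding tensor_concat_def
  by (rule tensor_lift_pure[OF vector_space_fscale multilinear_concat_left[OF assms(2)] assms(1)])

lemma tensor_concat_pure:
  assumes "xs \<in> tuples V p" "ys \<in> tuples V q"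
  shows "concat_tp p q (pure xs) (pure ys) = pure (xs @ ys)"
  using tensor_concat_pure_left[OF assms(1) pure_tensor_in[OF assms(2)]]
    tensor_lift_pure[OF vector_space_fscale multilinear_concat_right[OF assms(1)] assms(2)]
  by simp

lemma linear_concat_left:
  "u \<in> tp q \<Longrightarrow> linear_on fscale (tp p) fscale (\<lambda>t. concat_tp p q t u)"
  unfolding tensor_concat_def
  by (rule linear_tensor_lift[OF vector_space_fscale multilinear_concat_left])

text \<open>The second factor enters the outer lift only through the map being lifted, so it acts as
  a linear parameter.\<close>

lemma linear_concat_right:
  assumes "t \<in> tp p"
  shows "linear_on fscale (tp q) fscale (\<lambda>u. concat_tp p q t u)"
  unfolding tensor_concat_def
proof (rule tensor_lift_linear_param[OF vector_space_fscale vector_space_fscale subspace_tensor_power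
      multilinear_concat_left _ assms])
  fix xs assume "xs \<in> tuples V p"
  then show "linear_on fscale (tp q) fscale (\<lambda>u. tensor_lift scale V q fscale (\<lambda>ys. pure (xs @ ys)) u)"
    by (intro linear_tensor_lift[OF vector_space_fscale] multilinear_concat_right)
qed

lemma tensor_concat_closed:
  assumes "t \<in> tp p" "u \<in> tp q"
  shows "concat_tp p q t u \<in> tp (p + q)"
proof (rule tensor_power_closed[OF vector_space_fscale linear_concat_left[OF assms(2)]
      subspace_tensor_power _ assms(1)])
  fix xs assume xs: "xs \<in> tuples V p"
  show "concat_tp p q (pure xs) u \<in> tp (p + q)"
    by (rule tensor_power_closed[OF vector_space_fscale linear_concat_right[OF pure_tensor_in[OF xs]]
          subspace_tensor_power _ assms(2)])
      (simp add: tensor_concat_pure xs pure_tensor_in tuples_append)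
qed

section \<open>Tensoring a map with identities on both sides\<close>

context
  fixes a b :: nat and g
  assumes g_multilinear: "multilinear_on scale V a fscale g"
    and g_closed: "\<And>xs. xs \<in> tuples V a \<Longrightarrow> g xs \<in> tp b"
begin

text \<open>A single entry lies in exactly one of the three blocks cut out of \<open>xs\<close>.
  Changing it alters one factor, which depends linearly on it, and concatenation with the two fixed
  factors is linear.\<close>

lemma multilinear_id_tensor_id:
  "multilinear_on scale V (p + a + r) fscale
    (\<lambda>xs. concat_tp p (b + r) (pure (take p xs))
        (concat_tp b r (g (take a (drop p xs))) (pure (drop (p + a) xs))))"
    (is "multilinear_on _ _ _ _ ?f")
proof (rule multilinear_onI)
  fix xs i assume xs: "xs \<in> tuples V (p + a + r)" and i: "i < p + a + r"
  have 1: "take p xs \<in> tuples V p" using xs by (rule tuples_take) simp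
  have 2: "take a (drop p xs) \<in> tuples V a"
    by (rule tuples_take[OF tuples_drop[OF xs]]) auto
  have 3: "drop (p + a) xs \<in> tuples V r" by (rule tuples_drop[OF xs]) simp
  note gT = g_closed[OF 2]
  note P = pure_tensor_in[OF 1, where s = scale]
  note R = pure_tensor_in[OF 3, where s = scale]
  have ml: "linear_on scale V fscale (\<lambda>v. pure (ys[j := v]))" if "ys \<in> tuples V q" "j < q" for ys q j
    using multilinear_onD[OF multilinear_pure that] .
  consider "i < p" | j where "i = p + j" "j < a" | j where "i = p + a + j" "j < r"
    using i by (metis add_less_cancel_left le_Suc_ex linorder_not_le)
  then show "linear_on scale V fscale (\<lambda>v. ?f (xs[i := v]))"
  proof cases
    case i: 1
    have "linear_on scale V fscale (\<lambda>v. concat_tp p (b + r) (pure ((take p xs)[i := v]))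
        (concat_tp b r (g (take a (drop p xs))) (pure (drop (p + a) xs))))"
      by (rule linear_on_compose[OF ml[OF 1 i] linear_concat_left[OF tensor_concat_closed[OF gT R]]])
        (rule pure_tensor_in[OF tuples_update[OF 1]])
    then show ?thesis
      using i by (simp add: take_update_swap)
  next
    case i: (2 j)
    have "linear_on scale V fscale
        (\<lambda>v. concat_tp b r (g ((take a (drop p xs))[j := v])) (pure (drop (p + a) xs)))"
      by (rule linear_on_compose[OF multilinear_onD[OF g_multilinear 2 i(2)] linear_concat_left[OF R]])
        (rule g_closed[OF tuples_update[OF 2]])
    from linear_on_compose[OF this linear_concat_right[OF P]
        tensor_concat_closed[OF g_closed[OF tuples_update[OF 2]] R]]
    show ?thesis
      using i by (simp add: take_update_swap drop_update_swap list_update_beyond)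
  next
    case i: (3 j)
    have "linear_on scale V fscale
        (\<lambda>v. concat_tp b r (g (take a (drop p xs))) (pure ((drop (p + a) xs)[j := v])))"
      by (rule linear_on_compose[OF ml[OF 3 i(2)] linear_concat_right[OF gT]])
        (rule pure_tensor_in[OF tuples_update[OF 3]])
    from linear_on_compose[OF this linear_concat_right[OF P]
        tensor_concat_closed[OF gT pure_tensor_in[OF tuples_update[OF 3]]]]
    show ?thesis
      using i by (simp add: drop_update_swap)
  qed
qed

lemma linear_id_tensor_id:
  "linear_on fscale (tp (p + a + r)) fscale (id_tensor_id scale V p a b g r)"
  unfolding id_tensor_id_def
  by (rule linear_tensor_lift[OF vector_space_fscale multilinear_id_tensor_id])

lemma id_tensor_id_pure:
  "xs \<in> tuples V (p + a + r) \<Longrightarrow> id_tensor_id scale V p a b g r (pure xs) =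
    concat_tp p (b + r) (pure (take p xs))
        (concat_tp b r (g (take a (drop p xs))) (pure (drop (p + a) xs)))"
  unfolding id_tensor_id_def
  by (rule tensor_lift_pure[OF vector_space_fscale multilinear_id_tensor_id])

lemma id_tensor_id_closed:
  assumes "t \<in> tp (p + a + r)"
  shows "id_tensor_id scale V p a b g r t \<in> tp (p + b + r)"
proof (rule tensor_power_closed[OF vector_space_fscale linear_id_tensor_id subspace_tensor_power _ assms])
  fix xs assume xs: "xs \<in> tuples V (p + a + r)"
  have "take p xs \<in> tuples V p" by (rule tuples_take[OF xs]) simp
  moreover have "take a (drop p xs) \<in> tuples V a" by (rule tuples_take[OF tuples_drop[OF xs]]) auto
  moreover have "drop (p + a) xs \<in> tuples V r" by (rule tuples_drop[OF xs]) simp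
  ultimately show "id_tensor_id scale V p a b g r (pure xs) \<in> tp (p + b + r)"
    unfolding id_tensor_id_pure[OF xs] add.assoc[of p b r]
    by (intro tensor_concat_closed g_closed pure_tensor_in)
qed

end

section \<open>Products of linear forms\<close>

abbreviation "dual \<equiv> dual_space scale V"

lemma subspace_dual: "fscale.subspace dual"
  unfolding fscale.subspace_def dual_space_def linear_on_def
  by (auto simp: fscale_def algebra_simps)

lemma multilinear_forms:
  assumes fs: "fs \<in> tuples dual q"
  shows "multilinear_on scale V q (*) (\<lambda>xs. \<Prod>i<q. (fs ! i) (xs ! i))"
proof (rule multilinear_onI)
  fix xs i assume "xs \<in> tuples V q" and i: "i < q"
  then have len: "length xs = q" by (simp add: tuples_def)
  have "fs ! i \<in> dual" using fs i by (auto simp: tuples_def)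
  then show "linear_on scale V (*) (\<lambda>v. \<Prod>j<q. (fs ! j) (xs[i := v] ! j))"
    using i len prod_update[of i xs q "\<lambda>j. fs ! j"]
    by (auto simp: dual_space_def linear_on_def algebra_simps)
qed

lemma tensor_form_eq:
  "fs \<in> tuples dual q \<Longrightarrow>
    tensor_form scale V fs = tensor_lift scale V q (*) (\<lambda>xs. \<Prod>i<q. (fs ! i) (xs ! i))"
  by (simp add: tensor_form_def tuples_def)

lemma linear_tensor_form:
  assumes "fs \<in> tuples dual q"
  shows "linear_on fscale (tp q) (*) (tensor_form scale V fs)"
  unfolding tensor_form_eq[OF assms]
  by (rule linear_tensor_lift[OF vector_space_mult multilinear_forms[OF assms]])

lemma tensor_form_pure:
  assumes "fs \<in> tuples dual q" "xs \<in> tuples V q"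
  shows "tensor_form scale V fs (pure xs) = (\<Prod>i<q. (fs ! i) (xs ! i))"
  unfolding tensor_form_eq[OF assms(1)]
  by (rule tensor_lift_pure[OF vector_space_mult multilinear_forms[OF assms(1)] assms(2)])

text \<open>Here the tensor is fixed and the forms vary, so each form is a parameter of the lift,
  ranging over the subspace \<open>dual\<close>.\<close>

lemma multilinear_tensor_form:
  assumes "t \<in> tp q"
  shows "multilinear_on fscale dual q (*) (\<lambda>fs. tensor_form scale V fs t)"
proof (rule multilinear_onI)
  fix fs i assume fs: "fs \<in> tuples dual q" and i: "i < q"
  then have len: "length fs = q" by (simp add: tuples_def)
  have lin: "linear_on fscale dual (*) (\<lambda>f. \<Prod>j<q. (fs[i := f] ! j) (xs ! j))" for xs
    using i len prod_update[of i fs q "\<lambda>j f. f (xs ! j)"]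
    by (auto simp: linear_on_def fscale_def algebra_simps)
  have "linear_on fscale dual (*)
      (\<lambda>f. tensor_lift scale V q (*) (\<lambda>xs. \<Prod>j<q. (fs[i := f] ! j) (xs ! j)) t)"
    by (rule tensor_lift_linear_param[OF vector_space_mult vector_space_fscale subspace_dual
          multilinear_forms lin assms]) (rule tuples_update[OF fs])
  then show "linear_on fscale dual (*) (\<lambda>f. tensor_form scale V (fs[i := f]) t)"
    by (simp add: tensor_form_def len)
qed

text \<open>Both sides are linear in \<open>t\<close> and in \<open>u\<close>. Reducing first
  \<open>t\<close> and then \<open>u\<close> to pure tensors leaves a product over a concatenated
  list.\<close>

lemma tensor_form_concat:
  assumes fs: "fs \<in> tuples dual p" and gs: "gs \<in> tuples dual q" and t: "t \<in> tp p" and u: "u \<in> tp q"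
  shows "tensor_form scale V (fs @ gs) (concat_tp p q t u) =
    tensor_form scale V fs t * tensor_form scale V gs u"
proof -
  note fg = linear_tensor_form[OF tuples_append[OF fs gs]]
  \<comment> \<open>Used with \<open>c\<close> the value of \<open>tensor_form scale V fs\<close> at
    a pure tensor, after \<open>t\<close> has been reduced.\<close>
  have lin: "linear_on fscale (tp q) (*) (\<lambda>u. c * tensor_form scale V gs u)" for c
    by (rule linear_on_scale[OF vector_space_mult linear_tensor_form[OF gs]])
  have lin': "linear_on fscale (tp p) (*) (\<lambda>t. tensor_form scale V fs t * tensor_form scale V gs u)"
    using linear_on_scale[OF vector_space_mult linear_tensor_form[OF fs], of "tensor_form scale V gs u"]
    by (simp add: mult.commute)
  show ?thesis
  proof (rule tensor_power_unique[OF vector_space_mult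
        linear_on_compose[OF linear_concat_left[OF u] fg tensor_concat_closed[OF _ u]] lin' _ t])
    fix xs assume xs: "xs \<in> tuples V p"
    note X = pure_tensor_in[OF xs, of scale]
    show "tensor_form scale V (fs @ gs) (concat_tp p q (pure xs) u) =
      tensor_form scale V fs (pure xs) * tensor_form scale V gs u"
    proof (rule tensor_power_unique[OF vector_space_mult
          linear_on_compose[OF linear_concat_right[OF X] fg tensor_concat_closed[OF X]] lin _ u])
      fix ys assume ys: "ys \<in> tuples V q"
      show "tensor_form scale V (fs @ gs) (concat_tp p q (pure xs) (pure ys)) =
        tensor_form scale V fs (pure xs) * tensor_form scale V gs (pure ys)"
        using prod_append[of xs fs gs ys] fs gs xs
        by (simp add: tensor_concat_pure[OF xs ys] tensor_form_pure[OF fs xs] tensor_form_pure[OF gs ys]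
            tensor_form_pure[OF tuples_append[OF fs gs] tuples_append[OF xs ys]] tuples_def)
    qed
  qed
qed

lemma tensor_form_singleton: "f \<in> dual \<Longrightarrow> x \<in> V \<Longrightarrow> tensor_form scale V [f] (pure [x]) = f x"
  using tensor_form_pure[OF tuples_singleton tuples_singleton] by simp

end

section \<open>The dual multiplication\<close>

context partially_coassociative_coalgebra
begin

sublocale carrier_space scale M
  by unfold_locales (rule carrier)

sublocale dual: carrier_space fscale dual
  by unfold_locales (rule subspace_dual)

abbreviation "mult \<equiv> dual_mult scale M n \<Delta>"

lemma comult_in: "x \<in> M \<Longrightarrow> \<Delta> x \<in> tp n"
  using comult_closed by blast

text \<open>Linearity in each form is checked pointwise in \<open>x\<close>, where it is
  multilinearity of \<open>tensor_form\<close> at the fixed tensor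
  \<open>\<Delta> x\<close>.\<close>

lemma multilinear_transpose:
  "multilinear_on fscale dual n fscale (\<lambda>fs x. if x \<in> M then tensor_form scale M fs (\<Delta> x) else 0)"
proof (rule multilinear_onI)
  fix fs i assume fs: "fs \<in> tuples dual n" and i: "i < n"
  have "linear_on fscale dual (*) (\<lambda>f. tensor_form scale M (fs[i := f]) (\<Delta> x))" if "x \<in> M" for x
    using multilinear_onD[OF multilinear_tensor_form[OF comult_in[OF that]] fs i] .
  then show "linear_on fscale dual fscale
      (\<lambda>f x. if x \<in> M then tensor_form scale M (fs[i := f]) (\<Delta> x) else 0)"
    by (auto simp: linear_on_def fun_eq_iff fscale_def)
qed

lemma linear_mult: "linear_on fscale (dual.tp n) fscale mult"
  unfolding dual_mult_def by (rule linear_tensor_lift[OF vector_space_fscale multilinear_transpose])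

lemma mult_pure:
  "fs \<in> tuples dual n \<Longrightarrow>
    mult (dual.pure fs) = (\<lambda>x. if x \<in> M then tensor_form scale M fs (\<Delta> x) else 0)"
  unfolding dual_mult_def by (rule tensor_lift_pure[OF vector_space_fscale multilinear_transpose])

text \<open>The dual is a subspace, so pure tensors suffice. There the value is a linear form
  composed with \<open>\<Delta>\<close>, cut off to \<open>0\<close> outside \<open>M\<close> as
  \<open>dual_space\<close> demands.\<close>

lemma mult_in_dual: "t \<in> dual.tp n \<Longrightarrow> mult t \<in> dual"
proof (rule tensor_power_closed[OF vector_space_fscale linear_mult subspace_dual])
  fix fs assume fs: "fs \<in> tuples dual n"
  have "linear_on scale M (*) (\<lambda>x. tensor_form scale M fs (\<Delta> x))"
    using linear_on_compose[OF comult_linear linear_tensor_form[OF fs] comult_in] .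
  then have "linear_on scale M (*) (\<lambda>x. if x \<in> M then tensor_form scale M fs (\<Delta> x) else 0)"
    by (subst linear_on_cong[OF _ carrier vector_space_axioms]) auto
  then show "mult (dual.pure fs) \<in> dual" by (subst mult_pure[OF fs], subst dual_space_def) simp
qed

section \<open>Inserting the comultiplication and the multiplication\<close>

lemma multilinear_comult: "multilinear_on scale M 1 fscale (\<lambda>ys. \<Delta> (hd ys))"
proof (rule multilinear_onI)
  fix xs :: "'v list" and i :: nat assume "xs \<in> tuples M 1" "i < 1"
  then obtain x where "xs = [x]" "i = 0" by (auto simp: tuples_def length_Suc_conv)
  then show "linear_on scale M fscale (\<lambda>v. \<Delta> (hd (xs[i := v])))"
    using comult_linear by simp
qed

lemma comult_hd_in: "ys \<in> tuples M 1 \<Longrightarrow> \<Delta> (hd ys) \<in> tp n"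
  by (auto simp: tuples_def length_Suc_conv intro: comult_in)

lemma mult_singleton_in: "fs \<in> tuples dual n \<Longrightarrow> [mult (dual.pure fs)] \<in> tuples dual 1"
  by (intro tuples_singleton mult_in_dual pure_tensor_in)

lemma multilinear_mult_pure:
  "multilinear_on fscale dual n fscale (\<lambda>fs. dual.pure [mult (dual.pure fs)])"
proof -
  \<comment> \<open>The embedding into the first tensor power is linear by multilinearity of pure
    tensors of length one. The list \<open>[0]\<close> only supplies a slot to overwrite.\<close>
  have "linear_on fscale dual fscale (\<lambda>f. dual.pure [f])"
    using multilinear_onD[OF dual.multilinear_pure[of 1] tuples_singleton[OF fscale.subspace_0[OF subspace_dual]],
        of 0] by simp
  from multilinear_on_compose[OF multilinear_on_compose[OF dual.multilinear_pure linear_mult pure_tensor_in]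
      this mult_in_dual[OF pure_tensor_in]]
  show ?thesis .
qed

text \<open>Transposition turns a product inserted among the forms into a coproduct inserted among
  the vectors. Keeping \<open>t\<close> arbitrary instead of \<open>\<Delta> x\<close> lets both
  sides be compared on pure tensors.\<close>

lemma tensor_form_comult:
  assumes p: "p < n" and fs: "fs \<in> tuples dual (2 * n - 1)" and t: "t \<in> tp n"
  shows "tensor_form scale M (take p fs @ [mult (dual.pure (take n (drop p fs)))] @ drop (p + n) fs) t =
    tensor_form scale M fs (id_tensor_id scale M p 1 n (\<lambda>ys. \<Delta> (hd ys)) (n - 1 - p) t)"
proof -
  define r where "r = n - 1 - p"
  \<comment> \<open>Since \<open>p < n\<close>, the subtraction defining \<open>r\<close> is exact.
    The forms split into blocks of lengths \<open>p\<close>, \<open>n\<close>, \<open>r\<close>, the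
    vectors into blocks of lengths \<open>p\<close>, \<open>1\<close>, \<open>r\<close>.\<close>
  have n: "n = p + 1 + r" and n2: "2 * n - 1 = p + (n + r)" using p by (auto simp: r_def)
  define as where "as = take p fs"
  define bs where "bs = take n (drop p fs)"
  define cs where "cs = drop (p + n) fs"
  have as: "as \<in> tuples dual p" unfolding as_def by (rule tuples_take[OF fs]) (use n2 in simp)
  have bs: "bs \<in> tuples dual n" unfolding bs_def
    by (rule tuples_take[OF tuples_drop[OF fs n2]]) simp
  have cs: "cs \<in> tuples dual r" unfolding cs_def by (rule tuples_drop[OF fs]) (use n2 in simp)
  have fs_eq: "fs = as @ bs @ cs"
    by (simp add: as_def bs_def cs_def) (metis append_take_drop_id drop_drop add.commute)
  note m = mult_singleton_in[OF bs]
  have m_cs: "[mult (dual.pure bs)] @ cs \<in> tuples dual (1 + r)" by (rule tuples_append[OF m cs])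
  have all: "as @ [mult (dual.pure bs)] @ cs \<in> tuples dual (p + 1 + r)"
    using tuples_append[OF as m_cs] by (simp add: add.assoc)
  note ID = multilinear_comult comult_hd_in
  have fs': "fs \<in> tuples dual (p + n + r)" using fs n2 by (simp add: add.assoc)
  have "tensor_form scale M (as @ [mult (dual.pure bs)] @ cs) t =
    tensor_form scale M fs (id_tensor_id scale M p 1 n (\<lambda>ys. \<Delta> (hd ys)) r t)"
  proof (rule tensor_power_unique[OF vector_space_mult linear_tensor_form[OF all]
        linear_on_compose[OF linear_id_tensor_id[OF ID] linear_tensor_form[OF fs'] id_tensor_id_closed[OF ID]]])
    show "t \<in> tp (p + 1 + r)" using t n by simp
    fix xs assume xs: "xs \<in> tuples M (p + 1 + r)"
    define ys where "ys = take p xs"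
    define zs where "zs = drop (p + 1) xs"
    define x where "x = xs ! p"
    have len: "length xs = p + 1 + r" using xs by (simp add: tuples_def)
    have ys: "ys \<in> tuples M p" unfolding ys_def by (rule tuples_take[OF xs]) simp
    have zs: "zs \<in> tuples M r" unfolding zs_def by (rule tuples_drop[OF xs]) simp
    have x: "x \<in> M" using xs len by (auto simp: x_def tuples_def)
    have hd_drop: "hd (drop p xs) = x"
      using len by (simp add: x_def hd_drop_conv_nth)
    have xs_eq: "xs = ys @ [x] @ zs"
      using len by (simp add: ys_def zs_def x_def Cons_nth_drop_Suc)
    note x1 = tuples_singleton[OF x]
    note pure_x = pure_tensor_in[OF x1, of scale] and pure_ys = pure_tensor_in[OF ys, of scale]
      and pure_zs = pure_tensor_in[OF zs, of scale]
    have "tensor_form scale M (as @ [mult (dual.pure bs)] @ cs) (pure xs) =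
      tensor_form scale M (as @ [mult (dual.pure bs)] @ cs)
        (concat_tp p (1 + r) (pure ys) (concat_tp 1 r (pure [x]) (pure zs)))"
      unfolding tensor_concat_pure[OF x1 zs] tensor_concat_pure[OF ys tuples_append[OF x1 zs]] xs_eq ..
    \<comment> \<open>Multiplicativity separates the three blocks; the middle one is the single form
      \<open>mult (dual.pure bs)\<close> at \<open>x\<close>.\<close>
    also have "\<dots> = tensor_form scale M as (pure ys) * (mult (dual.pure bs) x * tensor_form scale M cs (pure zs))"
      unfolding tensor_form_concat[OF as m_cs pure_ys tensor_concat_closed[OF pure_x pure_zs]]
        tensor_form_concat[OF m cs pure_x pure_zs]
        tensor_form_singleton[OF mult_in_dual[OF pure_tensor_in[OF bs]] x] ..
    also have "\<dots> = tensor_form scale M as (pure ys) *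
        (tensor_form scale M bs (\<Delta> x) * tensor_form scale M cs (pure zs))"
      using x by (simp add: mult_pure[OF bs])
    \<comment> \<open>Multiplicativity read backwards, with the \<open>n\<close> forms
      \<open>bs\<close> now paired with \<open>\<Delta> x\<close>.\<close>
    also have "\<dots> = tensor_form scale M fs
        (concat_tp p (n + r) (pure ys) (concat_tp n r (\<Delta> x) (pure zs)))"
      unfolding fs_eq tensor_form_concat[OF as tuples_append[OF bs cs] pure_ys
          tensor_concat_closed[OF comult_in[OF x] pure_zs]]
        tensor_form_concat[OF bs cs comult_in[OF x] pure_zs] ..
    also have "\<dots> = tensor_form scale M fs (id_tensor_id scale M p 1 n (\<lambda>ys. \<Delta> (hd ys)) r (pure xs))"
      using id_tensor_id_pure[OF ID xs] by (simp add: hd_drop ys_def zs_def)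
    finally show "tensor_form scale M (as @ [mult (dual.pure bs)] @ cs) (pure xs) =
      tensor_form scale M fs (id_tensor_id scale M p 1 n (\<lambda>ys. \<Delta> (hd ys)) r (pure xs))" .
  qed
  then show ?thesis by (simp add: as_def bs_def cs_def r_def)
qed

abbreviation "insert_mult p \<equiv>
  id_tensor_id fscale dual p n 1 (\<lambda>fs. dual.pure [mult (dual.pure fs)]) (n - 1 - p)"

lemma linear_mult_insert:
  assumes "p < n"
  shows "linear_on fscale (dual.tp (2 * n - 1)) fscale (\<lambda>t. mult (insert_mult p t))"
proof -
  have eq: "p + n + (n - 1 - p) = 2 * n - 1" "p + 1 + (n - 1 - p) = n" using assms by auto
  note ID = multilinear_mult_pure pure_tensor_in[OF mult_singleton_in]
  show ?thesis
    using linear_on_compose[OF dual.linear_id_tensor_id[OF ID, of p "n - 1 - p"] linear_mult]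
      dual.id_tensor_id_closed[OF ID, of _ p "n - 1 - p"] unfolding eq by blast
qed

text \<open>On a pure tensor the insertion yields the pure tensor of \<open>n\<close> forms with
  \<open>mult (dual.pure bs)\<close> in position \<open>p\<close>. Its product at \<open>x\<close>
  is then given by \<open>tensor_form_comult\<close> for the tensor
  \<open>\<Delta> x\<close>.\<close>

lemma mult_insert_pure:
  assumes p: "p < n" and fs: "fs \<in> tuples dual (2 * n - 1)"
  shows "mult (insert_mult p (dual.pure fs)) =
    (\<lambda>x. if x \<in> M then tensor_form scale M fs
      (id_tensor_id scale M p 1 n (\<lambda>ys. \<Delta> (hd ys)) (n - 1 - p) (\<Delta> x)) else 0)"
proof -
  define r where "r = n - 1 - p"
  have n: "n = p + (1 + r)" and n2: "2 * n - 1 = p + (n + r)" using p by (auto simp: r_def)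
  define as where "as = take p fs"
  define bs where "bs = take n (drop p fs)"
  define cs where "cs = drop (p + n) fs"
  have as: "as \<in> tuples dual p" unfolding as_def by (rule tuples_take[OF fs]) (use n2 in simp)
  have bs: "bs \<in> tuples dual n" unfolding bs_def
    by (rule tuples_take[OF tuples_drop[OF fs n2]]) simp
  have cs: "cs \<in> tuples dual r" unfolding cs_def by (rule tuples_drop[OF fs]) (use n2 in simp)
  note m = mult_singleton_in[OF bs]
  have m_cs: "[mult (dual.pure bs)] @ cs \<in> tuples dual (1 + r)" by (rule tuples_append[OF m cs])
  have all: "as @ [mult (dual.pure bs)] @ cs \<in> tuples dual n"
    using tuples_append[OF as m_cs] n by simp
  have fs': "fs \<in> tuples dual (p + n + r)" using fs n2 by (simp add: add.assoc)
  note ID = multilinear_mult_pure pure_tensor_in[OF mult_singleton_in]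
  have "insert_mult p (dual.pure fs) = dual.pure (as @ [mult (dual.pure bs)] @ cs)"
    using dual.id_tensor_id_pure[OF ID fs'] dual.tensor_concat_pure[OF m cs]
      dual.tensor_concat_pure[OF as m_cs]
    unfolding as_def[symmetric] bs_def[symmetric] cs_def[symmetric] r_def[symmetric] by simp
  then show ?thesis
    using tensor_form_comult[OF p fs comult_in]
    by (simp only: mult_pure[OF all]) (simp add: as_def bs_def cs_def fun_eq_iff)
qed

text \<open>The signed sum is linear in \<open>t\<close>, so vanishing on pure tensors is enough,
  and this is checked at each point \<open>x\<close>.\<close>

lemma dual_partially_associative:
  assumes t: "t \<in> dual.tp (2 * n - 1)"
  shows "(\<Sum>p<n. fscale ((- 1) ^ (p * (n - 1))) (mult (insert_mult p t))) = 0"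
proof (rule tensor_power_unique[OF vector_space_fscale _ linear_on_zero_map[OF vector_space_fscale] _ t])
  show "linear_on fscale (dual.tp (2 * n - 1)) fscale
      (\<lambda>t. \<Sum>p<n. fscale ((- 1) ^ (p * (n - 1))) (mult (insert_mult p t)))"
    by (intro linear_on_sum linear_on_scale vector_space_fscale linear_mult_insert) simp
  fix fs assume fs: "fs \<in> tuples dual (2 * n - 1)"
  note pure_eq = fun_cong[OF mult_insert_pure[OF _ fs]]
  have "(\<Sum>p<n. fscale ((- 1) ^ (p * (n - 1))) (mult (insert_mult p (dual.pure fs)))) x = 0" for x
  proof (cases "x \<in> M")
    case True
    \<comment> \<open>All summands lie in the tensor power on which
      \<open>tensor_form scale M fs\<close> is linear, so the form can be pulled out of the signed
      sum.\<close>
    have in_tp: "id_tensor_id scale M p 1 n (\<lambda>ys. \<Delta> (hd ys)) (n - 1 - p) (\<Delta> x) \<in> tp (2 * n - 1)"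
      if "p < n" for p
    proof -
      have eq: "p + n + (n - 1 - p) = 2 * n - 1" "p + 1 + (n - 1 - p) = n" using that by auto
      show ?thesis
        using id_tensor_id_closed[OF multilinear_comult comult_hd_in, of "\<Delta> x" p "n - 1 - p"]
          comult_in[OF True] unfolding eq by blast
    qed
    have "(\<Sum>p<n. fscale ((- 1) ^ (p * (n - 1))) (mult (insert_mult p (dual.pure fs)))) x =
      (\<Sum>p<n. (- 1) ^ (p * (n - 1)) * tensor_form scale M fs
        (id_tensor_id scale M p 1 n (\<lambda>ys. \<Delta> (hd ys)) (n - 1 - p) (\<Delta> x)))"
      unfolding sum_fun_apply
      by (intro sum.cong refl) (simp only: fscale_apply pure_eq True if_True lessThan_iff)
    also have "\<dots> = tensor_form scale M fs (\<Sum>p<n. fscale ((- 1) ^ (p * (n - 1)))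
        (id_tensor_id scale M p 1 n (\<lambda>ys. \<Delta> (hd ys)) (n - 1 - p) (\<Delta> x)))"
      using linear_on_of_sum[OF vector_space_fscale vector_space_mult linear_tensor_form[OF fs]
          subspace_tensor_power, of "{..<n}"] in_tp by simp
    also have "\<dots> = 0"
      unfolding partially_coassociative[OF True]
      by (rule linear_on_0[OF vector_space_fscale vector_space_mult linear_tensor_form[OF fs]
            fscale.subspace_0[OF subspace_tensor_power]])
    finally show ?thesis .
  next
    \<comment> \<open>Outside \<open>M\<close> every summand takes the default value
      \<open>0\<close>.\<close>
    case False
    then show ?thesis
      unfolding sum_fun_apply
      by (intro sum.neutral ballI) (simp only: fscale_apply pure_eq False if_False lessThan_iff mult_zero_right)
  qed
  then show "(\<Sum>p<n. fscale ((- 1) ^ (p * (n - 1))) (mult (insert_mult p (dual.pure fs)))) = 0"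
    by (simp add: fun_eq_iff)
qed

end

theorem proposition5:
  fixes scale :: "'k::field_char_0 \<Rightarrow> 'm::ab_group_add \<Rightarrow> 'm"
    and M :: "'m set" and n :: nat and \<Delta> :: "'m \<Rightarrow> ('m, 'k) tensor"
  assumes "partially_coassociative_coalgebra scale M n \<Delta>"
  shows "partially_associative_algebra fscale (dual_space scale M) n (dual_mult scale M n \<Delta>)"
proof -
  interpret partially_coassociative_coalgebra scale M n \<Delta> by fact
  show ?thesis
    using subspace_dual mult_in_dual linear_mult dual_partially_associative
    by unfold_locales auto
qed

end
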